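(* For $m,n\geq2$ and $j\geq1$, the number of Fibonacci polyominoes $P\in\mathcal F_{m,n}$ with $\operatorname{lmin}(P)=j$ equals \[ B(m,j)\binom{n-2}{m-1}+B(m-1,j-1)\binom{n-2}{m-2}. \] For $m=1$, the unique polyomino in $\mathcal F_{1,n}$ has one left-to-right minimum.
   Context: A Fibonacci polyomino is a (nonempty) polyomino, considered up to translation, that is column-convex (each column is a contiguous segment of unit cells) and such that, reading columns from left to right, the bottom cell of each column lies exactly one unit above the bottom cell of the preceding column. Equivalently, it is given by a sequence of column heights $(h_1,\dots,h_m)$, $m\ge 1$, with $h_i\ge 2$ for $1\le i\le m-1$ and $h_m\ge 1$; column $i$ consists of the cells in column position $i$ and rows $i,i+1,\dots,i+h_i-1$. The horizontal (resp. vertical) semiperimeter is half the number of horizontal (resp. vertical) unit edges on the boundary (edges belonging to exactly one cell). $\mathcal F_{m,n}$ is the set of Fibonacci polyominoes with horizontal semiperimeter $m$ (equivalently $m$ columns) and vertical semiperimeter $n$. For $P$ with column heights $(h_1,\ldots,h_m)$, $\operatorname{lmin}(P)$ is the number of left-to-right minima, i.e. of columns $i$ such that $i=1$ or $h_i<\min\{h_1,\ldots,h_{i-1}\}$. $B(\ell,j)=\frac{j}{2\ell-j}\binom{2\ell-j}{\ell}$ for $1\le j\le\ell$ (the number of Dyck paths of semilength $\ell$ with exactly $j$ returns to the axis), $B(0,0)=1$, and $B(\ell,j)=0$ otherwise. Binomial coefficients $\binom ab$ with $a\ge0$ vanish if $b<0$ or $b>a$. *)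

theory Defs
  imports Complex_Main
begin

text \<open>The cell \<open>(x, y)\<close> is the unit square \<open>[x, x + 1] \<times> [y, y + 1]\<close>: \<open>x\<close> is its column, \<open>y\<close> its row.\<close>

type_synonym cell = "int \<times> int"

definition adjacent :: "cell \<Rightarrow> cell \<Rightarrow> bool" where
  "adjacent c d \<longleftrightarrow> \<bar>fst c - fst d\<bar> + \<bar>snd c - snd d\<bar> = 1"

definition polyomino :: "cell set \<Rightarrow> bool" where
  "polyomino P \<longleftrightarrow> finite P \<and> P \<noteq> {} \<and>
     (\<forall>c\<in>P. \<forall>d\<in>P. (c, d) \<in> {(a, b). a \<in> P \<and> b \<in> P \<and> adjacent a b}\<^sup>*)"

definition column :: "cell set \<Rightarrow> int \<Rightarrow> int set" where
  "column P x = {y. (x, y) \<in> P}"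

definition columns :: "cell set \<Rightarrow> int set" where
  "columns P = {x. column P x \<noteq> {}}"

definition height :: "cell set \<Rightarrow> int \<Rightarrow> nat" where
  "height P x = card (column P x)"

definition column_convex :: "cell set \<Rightarrow> bool" where
  "column_convex P \<longleftrightarrow>
     (\<forall>x. \<forall>y\<in>column P x. \<forall>z\<in>column P x. {y..z} \<subseteq> column P x)"

definition fibonacci_polyomino :: "cell set \<Rightarrow> bool" where
  "fibonacci_polyomino P \<longleftrightarrow> polyomino P \<and> column_convex P \<and>
     (\<forall>x. x \<in> columns P \<and> x + 1 \<in> columns P \<longrightarrow>
        Min (column P (x + 1)) = Min (column P x) + 1)"

text \<open>
  A pair \<open>(x, y)\<close> stands for the horizontal unit edge from \<open>(x, y)\<close> to \<open>(x + 1, y)\<close>, which is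
  shared by the cells \<open>(x, y)\<close> and \<open>(x, y - 1)\<close>; respectively for the vertical unit edge from
  \<open>(x, y)\<close> to \<open>(x, y + 1)\<close>, which is shared by the cells \<open>(x, y)\<close> and \<open>(x - 1, y)\<close>.  An edge is
  on the boundary if exactly one of its two cells belongs to the polyomino.
\<close>

definition horizontal_boundary :: "cell set \<Rightarrow> (int \<times> int) set" where
  "horizontal_boundary P = {(x, y). ((x, y) \<in> P) \<noteq> ((x, y - 1) \<in> P)}"

definition vertical_boundary :: "cell set \<Rightarrow> (int \<times> int) set" where
  "vertical_boundary P = {(x, y). ((x, y) \<in> P) \<noteq> ((x - 1, y) \<in> P)}"

definition horizontal_semiperimeter :: "cell set \<Rightarrow> real" where
  "horizontal_semiperimeter P = real (card (horizontal_boundary P)) / 2"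

definition vertical_semiperimeter :: "cell set \<Rightarrow> real" where
  "vertical_semiperimeter P = real (card (vertical_boundary P)) / 2"

text \<open>
  Polyominoes are considered up to translation: \<open>fibonacci_polyominoes m n\<close> is a
  translation-invariant set of cell sets, and counting is done in its quotient by \<open>translation\<close>.
\<close>

definition translation :: "(cell set \<times> cell set) set" where
  "translation = {(P, Q). \<exists>a b. Q = (\<lambda>(x, y). (x + a, y + b)) ` P}"

definition fibonacci_polyominoes :: "nat \<Rightarrow> nat \<Rightarrow> cell set set" where
  "fibonacci_polyominoes m n = {P. fibonacci_polyomino P \<and>
     horizontal_semiperimeter P = real m \<and> vertical_semiperimeter P = real n}"

definition lmin :: "cell set \<Rightarrow> nat" where
  "lmin P = card {x \<in> columns P.
     {x' \<in> columns P. x' < x} = {} \<or> height P x < Min (height P ` {x' \<in> columns P. x' < x})}"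

definition B :: "nat \<Rightarrow> nat \<Rightarrow> real" where
  "B l j = (if 1 \<le> j \<and> j \<le> l then real j / real (2 * l - j) * real ((2 * l - j) choose l)
            else if l = 0 \<and> j = 0 then 1 else 0)"

lemma equiv_translation: "equiv UNIV translation"
proof (rule equivI)
  show "refl translation"
    unfolding refl_on_def translation_def
    by (auto intro!: exI[of _ 0])
  show "sym translation"
  proof (rule symI)
    fix P Q assume "(P, Q) \<in> translation"
    then obtain a b where "Q = (\<lambda>(x, y). (x + a, y + b)) ` P"
      by (auto simp: translation_def)
    then have "P = (\<lambda>(x, y). (x + (- a), y + (- b))) ` Q"
      by (simp add: image_image case_prod_unfold)
    then show "(Q, P) \<in> translation"
      unfolding translation_def by blast
  qed
  show "trans translation"
  proof (rule transI)
    fix P Q R assume "(P, Q) \<in> translation" "(Q, R) \<in> translation"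
    then obtain a b c d where "Q = (\<lambda>(x, y). (x + a, y + b)) ` P"
      and "R = (\<lambda>(x, y). (x + c, y + d)) ` Q"
      by (auto simp: translation_def)
    then have "R = (\<lambda>(x, y). (x + (a + c), y + (b + d))) ` P"
      by (simp add: image_image case_prod_unfold add.assoc)
    then show "(P, R) \<in> translation"
      unfolding translation_def by blast
  qed
qed simp

end

theory Submission
  imports Defs
begin

text \<open>
  A Fibonacci polyomino with columns \<open>h\<^sub>1, \<dots>, h\<^sub>m\<close> has vertical semiperimeter
  \<open>h\<^sub>1 + \<Sum> max 0 (h\<^sub>i\<^sub>+\<^sub>1 + 1 - h\<^sub>i)\<close>. Subtracting 2 from all heights, or from all but the last one
  if that is 1, reduces the count to arbitrary sequences of natural numbers, and the two cases give
  the two terms of the formula.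

  Among the sequences of length \<open>m\<close> fix the set \<open>D\<close> of values of the left-to-right minima and the
  total climb \<open>R\<close>. Their number depends on \<open>D\<close> only through \<open>j = card D\<close>: it is \<open>B m j\<close> times the
  number of compositions of \<open>R\<close> into \<open>m - j\<close> positive parts. This follows by induction on \<open>m\<close>,
  removing the first entry, which adds an arbitrary set of larger minima; the recurrence that
  results is \<open>B (m + 1) (j + 1) = B m j + B m (j + 1) + \<dots> + B m m\<close>. Summing over \<open>D\<close> turns the
  number of compositions into a binomial coefficient.
\<close>

section \<open>Ballot numbers and binomial sums\<close>

text \<open>The numbers \<open>B\<close>, given by the recurrence that removing the first entry of a
  sequence produces. Counting thus stays in the natural numbers; \<open>ballot_eq_B\<close> supplies
  the closed form.\<close>

fun ballot :: "nat \<Rightarrow> nat \<Rightarrow> nat" where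
  "ballot 0 j = (if j = 0 then 1 else 0)"
| "ballot (Suc m) 0 = 0"
| "ballot (Suc m) (Suc j) = (\<Sum>i=j..m. ballot m i)"

lemma ballot_eq_0: "m < j \<Longrightarrow> ballot m j = 0"
  by (cases m; cases j) auto

lemma B_ballot_step:
  assumes "j \<le> m"
  shows "B (Suc m) (Suc j) = B m j + B (Suc m) (Suc (Suc j))"
proof (cases "m = j")
  case True
  then show ?thesis by (cases "j = 0") (auto simp: B_def field_simps)
next
  case False
  then obtain e where m: "m = j + Suc e"
    using assms by (metis less_imp_Suc_add add_Suc_right le_neq_implies_less)
  \<comment> \<open>This is \<open>2 * m - j\<close>. By symmetry and Pascal's rule all three values
    of \<open>B\<close> become multiples of \<open>X\<close>, \<open>Y\<close> or
    \<open>X + Y\<close>, with neighbours \<open>X\<close>, \<open>Y\<close> in row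
    \<open>n\<close>, and absorption relates these two.\<close>
  define n where "n = j + 2 * e + 2"
  define X Y where "X = real (n choose e)" and "Y = real (n choose Suc e)"
  have "Suc e * (n choose Suc e) = (n - e) * (n choose e)"
    by (metis binomial_absorb_comp binomial_absorption)
  moreover have "n - e = j + e + 2" by (simp add: n_def)
  ultimately have "real (Suc e) * Y = real (j + e + 2) * X"
    unfolding X_def Y_def by (metis of_nat_mult)
  then have XY: "(real e + 1) * Y = (real j + real e + 2) * X" by (simp add: algebra_simps)
  have 1: "B (Suc m) (Suc j) = (real j + 1) / (real n + 1) * (X + Y)"
  proof -
    have "2 * Suc m - Suc j = Suc n" by (simp add: m n_def)
    moreover have "Suc n choose Suc m = Suc n choose Suc e"
      using binomial_symmetric[of "Suc m" "Suc n"] by (simp add: m n_def)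
    ultimately show ?thesis
      using assms by (simp add: B_def X_def Y_def add.commute)
  qed
  have 2: "B m j = real j / real n * Y"
  proof -
    have "2 * m - j = n" by (simp add: m n_def)
    moreover have "n choose m = n choose Suc e"
      using binomial_symmetric[of m n] by (simp add: m n_def)
    ultimately show ?thesis
      using assms by (cases "j = 0") (auto simp: B_def Y_def m)
  qed
  have 3: "B (Suc m) (Suc (Suc j)) = (real j + 2) / real n * X"
  proof -
    have "2 * Suc m - Suc (Suc j) = n" by (simp add: m n_def)
    moreover have "n choose Suc m = n choose e"
      using binomial_symmetric[of "Suc m" n] by (simp add: m n_def)
    ultimately show ?thesis
      by (simp add: B_def X_def m)
  qed
  have n: "real n = real j + 2 * real e + 2" by (simp add: n_def)
  have "real n > 0" by (simp add: n)
  then show ?thesis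
    unfolding 1 2 3 using XY by (simp add: field_simps) (simp add: n, algebra)
qed

lemma ballot_eq_B: "real (ballot m j) = B m j"
proof (induction m arbitrary: j)
  case 0
  then show ?case by (simp add: B_def)
next
  case (Suc m)
  \<comment> \<open>The tail sums telescope by \<open>B_ballot_step\<close>, so the induction runs
    downwards from the empty sum at \<open>k = Suc m\<close>.\<close>
  have sum_B: "(\<Sum>i=k..m. B m i) = B (Suc m) (Suc k)" if "k \<le> Suc m" for k
    using that
  proof (induction k rule: inc_induct)
    case base
    then show ?case by (simp add: B_def)
  next
    case (step k)
    then show ?case by (simp add: sum.atLeast_Suc_atMost B_ballot_step)
  qed
  show ?case
  proof (cases j)
    case 0
    then show ?thesis by (simp add: B_def)
  next
    case (Suc k)
    then show ?thesis
      using sum_B[of k] by (cases "k \<le> Suc m") (auto simp: Suc.IH B_def)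
  qed
qed

text \<open>Ordered sums of \<open>k\<close> positive parts with total \<open>R\<close>. The case
  split keeps truncated subtraction out of the formula "\<open>R - 1\<close> choose
  \<open>k - 1\<close>".\<close>

fun compositions :: "nat \<Rightarrow> nat \<Rightarrow> nat" where
  "compositions 0 R = (if R = 0 then 1 else 0)"
| "compositions (Suc k) 0 = 0"
| "compositions (Suc k) (Suc R) = R choose k"

text \<open>Sort the subsets of size \<open>s + t + 1\<close> of \<open>{0..N}\<close> by their
  element \<open>b\<close> of rank \<open>s + 1\<close>: \<open>s\<close> elements lie among the
  \<open>b\<close> smaller numbers, \<open>t\<close> among the \<open>N - b\<close> larger ones. The
  proof uses Pascal's rule on the second factor.\<close>

lemma sum_choose_mult_choose_diff:
  "(\<Sum>b\<le>N. (b choose s) * ((N - b) choose t)) = Suc N choose Suc (s + t)"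
proof (induction N arbitrary: t)
  case 0
  then show ?case by (cases s; cases t) auto
next
  case (Suc N)
  show ?case
  proof (cases t)
    case 0
    then show ?thesis using sum_choose_upper[of s "Suc N"] by (simp add: atMost_atLeast0)
  next
    case (Suc u)
    have "(\<Sum>b\<le>Suc N. (b choose s) * ((Suc N - b) choose t)) =
        (\<Sum>b\<le>N. (b choose s) * (Suc (N - b) choose Suc u))"
      using Suc by (simp add: Suc_diff_le)
    also have "\<dots> = (\<Sum>b\<le>N. (b choose s) * ((N - b) choose u)) + (\<Sum>b\<le>N. (b choose s) * ((N - b) choose t))"
      by (simp add: Suc algebra_simps sum.distrib)
    finally show ?thesis using Suc by (simp add: Suc.IH)
  qed
qed

text \<open>For \<open>k > 0\<close> the term \<open>b = N\<close> vanishes and the rest is the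
  preceding convolution; for \<open>k = 0\<close> only \<open>b = N\<close> survives. Both the sum
  over absorbed sets and the final sum over \<open>D\<close> are evaluated this way.\<close>

lemma sum_choose_mult_compositions:
  "(\<Sum>b\<le>N. (b choose s) * compositions k (N - b)) = N choose (s + k)"
proof (cases k)
  case 0
  have "(\<Sum>b\<le>N. (b choose s) * compositions 0 (N - b)) = (\<Sum>b\<in>{N}. (b choose s) * compositions 0 (N - b))"
    by (rule sum.mono_neutral_right) auto
  then show ?thesis using 0 by simp
next
  case (Suc t)
  show ?thesis
  proof (cases N)
    case 0
    then show ?thesis using Suc by simp
  next
    case (Suc M)
    have "(\<Sum>b\<le>N. (b choose s) * compositions k (N - b)) = (\<Sum>b\<le>M. (b choose s) * ((M - b) choose t))"
      using Suc \<open>k = Suc t\<close> by (simp add: Suc_diff_le)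
    then show ?thesis
      using Suc \<open>k = Suc t\<close> by (simp add: sum_choose_mult_choose_diff)
  qed
qed

text \<open>Subsets are grouped by size. Any upper bound \<open>K\<close> is allowed, so that one
  range of \<open>k\<close> can serve sets \<open>A\<close> of different sizes and the sums can be
  exchanged.\<close>

lemma sum_Pow_card:
  fixes \<phi> :: "nat \<Rightarrow> nat"
  assumes "finite A" "card A \<le> K"
  shows "(\<Sum>F\<in>Pow A. \<phi> (card F)) = (\<Sum>k\<le>K. (card A choose k) * \<phi> k)"
proof -
  have "(\<Sum>F\<in>Pow A. \<phi> (card F)) = (\<Sum>k\<le>K. \<Sum>F\<in>{F \<in> Pow A. card F = k}. \<phi> (card F))"
    using assms by (intro sum.group[symmetric]) (auto intro: card_mono order_trans)
  also have "\<dots> = (\<Sum>k\<le>K. (card A choose k) * \<phi> k)"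
  proof (rule sum.cong[OF refl])
    fix k
    have "(\<Sum>F\<in>{F \<in> Pow A. card F = k}. \<phi> (card F)) = card {F \<in> Pow A. card F = k} * \<phi> k"
      by simp
    then show "(\<Sum>F\<in>{F \<in> Pow A. card F = k}. \<phi> (card F)) = (card A choose k) * \<phi> k"
      using n_subsets[OF assms(1), of k] by simp
  qed
  finally show ?thesis .
qed

text \<open>A nonempty \<open>E\<close> is its maximum \<open>a + b\<close> together with an
  arbitrary set \<open>F\<close> of smaller elements. The maximum is split off because
  \<open>ascent a E\<close> depends on nothing else for nonempty \<open>E\<close>.\<close>

lemma sum_Pow_by_Max:
  fixes g :: "nat set \<Rightarrow> nat" and a :: nat
  shows "(\<Sum>E\<in>Pow {a..<a + R}. g E) = g {} + (\<Sum>b<R. \<Sum>F\<in>Pow {a..<a + b}. g (insert (a + b) F))"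
proof (induction R)
  case 0
  then show ?case by simp
next
  case (Suc R)
  have "Pow {a..<a + Suc R} = Pow {a..<a + R} \<union> insert (a + R) ` Pow {a..<a + R}"
    by (simp add: atLeastLessThanSuc Pow_insert)
  moreover have "Pow {a..<a + R} \<inter> insert (a + R) ` Pow {a..<a + R} = {}" by auto
  moreover have "inj_on (insert (a + R)) (Pow {a..<a + R})"
    by (rule inj_onI) (metis PowD atLeastLessThan_iff insert_ident less_irrefl subsetD)
  ultimately show ?case
    using Suc.IH by (simp add: sum.union_disjoint sum.reindex)
qed

section \<open>Sequences with prescribed left-to-right minima\<close>

text \<open>
  The staircase polyomino with column heights \<open>h\<close> has vertical semiperimeter \<open>hd h + climb h\<close>.
  The truncated subtraction is intended: a step contributes only when the top cell rises.
\<close>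

fun climb :: "nat list \<Rightarrow> nat" where
  "climb (a # b # q) = (b + 1 - a) + climb (b # q)"
| "climb q = 0"

text \<open>Minima are recorded by value, not by position. They decrease strictly, so no count is
  lost, and the largest value is the first entry.\<close>

fun lrmins :: "nat list \<Rightarrow> nat set" where
  "lrmins [] = {}"
| "lrmins (a # q) = insert a {x \<in> lrmins q. x < a}"

lemma finite_lrmins [simp]: "finite (lrmins q)"
  by (induction q) auto

lemma lrmins_eq_empty_iff [simp]: "lrmins q = {} \<longleftrightarrow> q = []"
  by (cases q) auto

lemma Max_lrmins: "q \<noteq> [] \<Longrightarrow> Max (lrmins q) = hd q"
  by (cases q) (auto intro!: Max_eqI)

text \<open>
  In \<open>a # q\<close> the left-to-right minima of \<open>q\<close> below \<open>a\<close> survive and the set \<open>E\<close> of the others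
  is absorbed. The climb from \<open>a\<close> to the first entry of \<open>q\<close> depends on \<open>E\<close> only, since that
  entry is the largest left-to-right minimum of \<open>q\<close>.
\<close>

definition ascent :: "nat \<Rightarrow> nat set \<Rightarrow> nat" where
  "ascent a E = (if E = {} then 0 else Max E + 1 - a)"

lemma climb_Cons: "climb (a # q) = ascent a {x \<in> lrmins q. a \<le> x} + climb q"
proof (cases q)
  case Nil
  then show ?thesis by (simp add: ascent_def)
next
  case (Cons b r)
  have "ascent a {x \<in> lrmins q. a \<le> x} = b + 1 - a"
  proof (cases "a \<le> b")
    case True
    then have "Max {x \<in> lrmins q. a \<le> x} = b"
      using Cons by (intro Max_eqI) auto
    moreover have "{x \<in> lrmins q. a \<le> x} \<noteq> {}" using True Cons by auto
    ultimately show ?thesis by (auto simp: ascent_def)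
  next
    case False
    then have "{x \<in> lrmins q. a \<le> x} = {}" using Cons by auto
    with False show ?thesis by (simp add: ascent_def)
  qed
  then show ?thesis using Cons by simp
qed

definition seqs :: "nat \<Rightarrow> nat set \<Rightarrow> nat \<Rightarrow> nat list set" where
  "seqs m D R = {p. length p = m \<and> lrmins p = D \<and> climb p = R}"

text \<open>The first entry must be the largest minimum \<open>a\<close>; the tail keeps the other
  minima and has a set \<open>E\<close> of absorbed ones. Climbing from \<open>a\<close> to
  \<open>Max E\<close> costs \<open>Max E + 1 - a\<close>, which confines \<open>E\<close> to
  \<open>{a..<a + R}\<close>.\<close>

lemma seqs_Suc:
  assumes D: "finite D" "D \<noteq> {}" and a: "a = Max D"
  shows "seqs (Suc m) D R =
    (#) a ` (\<Union>E\<in>Pow {a..<a + R}. seqs m ((D - {a}) \<union> E) (R - ascent a E))"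
    (is "?L = (#) a ` ?U")
proof (intro equalityI subsetI)
  fix p assume p: "p \<in> ?L"
  then obtain c q where pq: "p = c # q" by (cases p) (auto simp: seqs_def)
  have "c = a" using p Max_lrmins[of p] by (simp add: seqs_def a pq)
  define E where "E = {x \<in> lrmins q. a \<le> x}"
  have R: "R = ascent a E + climb q"
    using p by (auto simp: seqs_def pq \<open>c = a\<close> climb_Cons E_def)
  have "E \<subseteq> {a..<a + R}"
  proof
    fix x assume x: "x \<in> E"
    then have "x \<le> Max E" "a \<le> x" by (auto simp: E_def)
    with x show "x \<in> {a..<a + R}" using R by (auto simp: ascent_def split: if_splits)
  qed
  moreover have "lrmins q = (D - {a}) \<union> E"
    using p by (auto simp: seqs_def pq \<open>c = a\<close> E_def)
  ultimately have "q \<in> ?U" using p R by (auto simp: seqs_def pq intro!: bexI[of _ E])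
  then show "p \<in> (#) a ` ?U" by (simp add: pq \<open>c = a\<close>)
next
  fix p assume "p \<in> (#) a ` ?U"
  then obtain q E where pq: "p = a # q" and E: "E \<subseteq> {a..<a + R}"
    and q: "length q = m" "lrmins q = (D - {a}) \<union> E" "climb q = R - ascent a E"
    by (auto simp: seqs_def)
  have lt: "x < a" if "x \<in> D - {a}" for x
    using that Max_ge[OF D(1), of x] a by auto
  have "a \<in> D" using D a by simp
  have 1: "{x \<in> lrmins q. a \<le> x} = E" "{x \<in> lrmins q. x < a} = D - {a}"
    using q(2) lt E by fastforce+
  have "finite E" using E finite_subset by blast
  \<comment> \<open>This makes \<open>R - ascent a E\<close> a genuine difference, so that the climb
    of \<open>a # q\<close> adds up to \<open>R\<close>.\<close>
  have "ascent a E \<le> R"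
  proof (cases "E = {}")
    case False
    then have "Max E \<in> {a..<a + R}" using E \<open>finite E\<close> Max_in by blast
    then show ?thesis by (auto simp: ascent_def)
  qed (simp add: ascent_def)
  then show "p \<in> ?L"
    using q 1 \<open>a \<in> D\<close> by (auto simp: seqs_def pq climb_Cons simp del: climb.simps)
qed

text \<open>The convolution gives the absorbed sets \<open>E\<close> of each fixed size the same
  factor \<open>compositions (m - j) R\<close>, where \<open>j = card D - 1\<close>; what remains is
  the tail sum defining \<open>ballot\<close>. For \<open>card D > m\<close> the truncated
  difference is harmless, as the ballot number vanishes.\<close>

lemma seqs_finite_card:
  "finite D \<Longrightarrow> finite (seqs m D R) \<and>
     card (seqs m D R) = ballot m (card D) * compositions (m - card D) R"
proof (induction m arbitrary: D R)
  case 0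
  have "seqs 0 D R = (if D = {} \<and> R = 0 then {[]} else {})"
    by (auto simp: seqs_def)
  then show ?case using 0 by auto
next
  case (Suc m)
  show ?case
  proof (cases "D = {}")
    case True
    then have "seqs (Suc m) D R = {}" by (auto simp: seqs_def)
    then show ?thesis using True by simp
  next
    case False
    define a j where "a = Max D" and "j = card (D - {a})"
    have aD: "a \<in> D" and cD: "card D = Suc j"
      using Suc.prems False by (simp_all add: a_def j_def card_gt_0_iff)
    have lt: "x < a" if "x \<in> D - {a}" for x
      using that Max_ge[OF Suc.prems, of x] a_def by auto
    define T where "T E = seqs m ((D - {a}) \<union> E) (R - ascent a E)" for E
    define g where "g E = ballot m (j + card E) * compositions (m - (j + card E)) (R - ascent a E)" for E
    have T: "finite (T E) \<and> card (T E) = g E" if "E \<in> Pow {a..<a + R}" for E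
    proof -
      have "finite E" using that finite_subset by blast
      moreover have "(D - {a}) \<inter> E = {}" using that lt by fastforce
      ultimately have "card ((D - {a}) \<union> E) = j + card E"
        using Suc.prems by (simp add: j_def card_Un_disjoint)
      then show ?thesis
        using Suc.IH[of "(D - {a}) \<union> E"] \<open>finite E\<close> Suc.prems by (simp add: T_def g_def)
    qed
    have disj: "T E \<inter> T F = {}" if "E \<in> Pow {a..<a + R}" "F \<in> Pow {a..<a + R}" "E \<noteq> F" for E F
    proof (rule ccontr)
      assume "T E \<inter> T F \<noteq> {}"
      then have eq: "(D - {a}) \<union> E = (D - {a}) \<union> F" by (auto simp: T_def seqs_def)
      \<comment> \<open>The absorbed set can be read off from the tail: it consists of the minima
        that are at least \<open>a\<close>.\<close>
      have "G = {x \<in> (D - {a}) \<union> G. a \<le> x}" if "G \<in> Pow {a..<a + R}" for G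
        using that lt by (auto simp: not_le[symmetric])
      then show False using that eq by metis
    qed
    have S: "seqs (Suc m) D R = (#) a ` (\<Union>E\<in>Pow {a..<a + R}. T E)"
      unfolding T_def by (rule seqs_Suc[OF Suc.prems False a_def])
    have "card (seqs (Suc m) D R) = card (\<Union>E\<in>Pow {a..<a + R}. T E)"
      unfolding S by (rule card_image) auto
    also have "\<dots> = (\<Sum>E\<in>Pow {a..<a + R}. g E)"
      using T disj by (subst card_UN_disjoint) auto
    also have "\<dots> = g {} + (\<Sum>b<R. \<Sum>F\<in>Pow {a..<a + b}. g (insert (a + b) F))"
      by (rule sum_Pow_by_Max)
    \<comment> \<open>The bound \<open>R + m\<close> is common to all \<open>b\<close>: it exceeds
      \<open>card F\<close>, since \<open>card F \<le> b < R\<close>, and it takes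
      \<open>j + Suc k\<close> past \<open>m\<close>, where the ballot numbers are zero.\<close>
    also have "(\<Sum>b<R. \<Sum>F\<in>Pow {a..<a + b}. g (insert (a + b) F)) =
        (\<Sum>b<R. \<Sum>k\<le>R + m. (b choose k) *
          (ballot m (j + Suc k) * compositions (m - (j + Suc k)) (R - Suc b)))"
    proof (rule sum.cong[OF refl])
      fix b assume "b \<in> {..<R}"
      have "g (insert (a + b) F) =
          ballot m (j + Suc (card F)) * compositions (m - (j + Suc (card F))) (R - Suc b)"
        if "F \<in> Pow {a..<a + b}" for F
      proof -
        have "finite F" "a + b \<notin> F" using that finite_subset by auto
        moreover have "Max (insert (a + b) F) = a + b"
          using that \<open>finite F\<close> by (intro Max_eqI) fastforce+
        ultimately show ?thesis by (simp add: g_def ascent_def)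
      qed
      then have "(\<Sum>F\<in>Pow {a..<a + b}. g (insert (a + b) F)) = (\<Sum>F\<in>Pow {a..<a + b}.
          ballot m (j + Suc (card F)) * compositions (m - (j + Suc (card F))) (R - Suc b))"
        by (rule sum.cong[OF refl])
      also have "\<dots> = (\<Sum>k\<le>R + m. (card {a..<a + b} choose k) *
          (ballot m (j + Suc k) * compositions (m - (j + Suc k)) (R - Suc b)))"
        using \<open>b \<in> {..<R}\<close> by (intro sum_Pow_card) auto
      finally show "(\<Sum>F\<in>Pow {a..<a + b}. g (insert (a + b) F)) = (\<Sum>k\<le>R + m. (b choose k) *
          (ballot m (j + Suc k) * compositions (m - (j + Suc k)) (R - Suc b)))" by simp
    qed
    also have "\<dots> = (\<Sum>k\<le>R + m. ballot m (j + Suc k) *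
        (\<Sum>b<R. (b choose k) * compositions (m - (j + Suc k)) (R - Suc b)))"
      by (subst sum.swap) (simp add: sum_distrib_left ac_simps)
    \<comment> \<open>For \<open>R = Suc N\<close> the inner sum is \<open>N\<close> choose
      \<open>m - j - 1\<close>, independent of \<open>k\<close>, whenever its ballot factor can be
      nonzero.\<close>
    also have "\<dots> = (\<Sum>k\<le>R + m. ballot m (j + Suc k) * compositions (m - j) R)"
    proof (rule sum.cong[OF refl])
      fix k
      show "ballot m (j + Suc k) * (\<Sum>b<R. (b choose k) * compositions (m - (j + Suc k)) (R - Suc b)) =
        ballot m (j + Suc k) * compositions (m - j) R"
      proof (cases "j + Suc k \<le> m")
        case True
        then have mj: "m - j = Suc (k + (m - (j + Suc k)))" by simp
        show ?thesis
        proof (cases R)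
          case 0
          then show ?thesis by (simp add: mj)
        next
          case (Suc N)
          then have "(\<Sum>b<R. (b choose k) * compositions (m - (j + Suc k)) (R - Suc b)) =
              N choose (k + (m - (j + Suc k)))"
            by (simp add: lessThan_Suc_atMost sum_choose_mult_compositions)
          then show ?thesis unfolding mj Suc by simp
        qed
      next
        case False
        then show ?thesis by (simp add: ballot_eq_0)
      qed
    qed
    also have "\<dots> = (\<Sum>k\<le>R + m. ballot m (j + Suc k)) * compositions (m - j) R"
      by (simp add: sum_distrib_right)
    \<comment> \<open>The empty set has ascent 0, carries the same factor, and supplies the missing
      term \<open>i = j\<close> of the tail sum.\<close>
    also have "g {} + \<dots> = (ballot m j + (\<Sum>k\<le>R + m. ballot m (j + Suc k))) * compositions (m - j) R"
      by (simp add: g_def ascent_def algebra_simps)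
    also have "ballot m j + (\<Sum>k\<le>R + m. ballot m (j + Suc k)) = (\<Sum>k\<le>Suc (R + m). ballot m (j + k))"
      by (simp add: sum.atMost_Suc_shift del: sum.atMost_Suc)
    also have "\<dots> = (\<Sum>i=j..j + Suc (R + m). ballot m i)"
      using sum.shift_bounds_cl_nat_ivl[of "ballot m" 0 j "Suc (R + m)"]
      by (simp add: atMost_atLeast0 add.commute)
    also have "\<dots> = (\<Sum>i=j..m. ballot m i)"
      by (rule sum.mono_neutral_right) (auto simp: ballot_eq_0)
    finally have "card (seqs (Suc m) D R) = ballot (Suc m) (card D) * compositions (Suc m - card D) R"
      by (simp add: cD)
    moreover have "finite (seqs (Suc m) D R)" unfolding S using T by auto
    ultimately show ?thesis by blast
  qed
qed

text \<open>Write the set of minima as \<open>insert b F\<close> with first entry \<open>b\<close>.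
  Then \<open>N - b\<close> is left for the climb, and there are \<open>b\<close> choose
  \<open>j - 1\<close> sets \<open>F\<close> when \<open>j > 0\<close>; the convolution over
  \<open>b\<close> gives \<open>N\<close> choose \<open>m - 1\<close>.\<close>

lemma card_lists_by_lrmins:
  fixes m N j :: nat
  assumes "1 \<le> m"
  defines "A \<equiv> {p. length p = m \<and> hd p + climb p = N \<and> card (lrmins p) = j}"
  shows "finite A" "card A = ballot m j * (N choose (m - 1))"
proof -
  define T where "T b F = seqs m (insert b F) (N - b)" for b F
  define I where "I = (SIGMA b:{..N}. {F. F \<subseteq> {..<b} \<and> Suc (card F) = j})"
  have fin: "finite F" if "F \<subseteq> {..<b}" for F and b :: nat
    using that finite_subset by blast
  have finI: "finite I" unfolding I_def
    by (intro finite_SigmaI) (auto intro: finite_subset[of _ "Pow {..<_}"])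
  have Mx: "Max (insert b F) = b" if "F \<subseteq> {..<b}" for F and b :: nat
    using that fin[OF that] by (intro Max_eqI) fastforce+
  have A: "A = (\<Union>(b, F)\<in>I. T b F)"
  proof (intro equalityI subsetI)
    fix p assume p: "p \<in> A"
    then obtain a q where pq: "p = a # q" using assms(1) by (cases p) (auto simp: A_def)
    have "(a, {x \<in> lrmins q. x < a}) \<in> I" using p by (auto simp: I_def A_def pq)
    moreover have "p \<in> T a {x \<in> lrmins q. x < a}" using p by (auto simp: A_def pq T_def seqs_def)
    ultimately show "p \<in> (\<Union>(b, F)\<in>I. T b F)" by blast
  next
    fix p assume "p \<in> (\<Union>(b, F)\<in>I. T b F)"
    then obtain b F where bF: "(b, F) \<in> I" and p: "p \<in> T b F" by blast
    then have F: "F \<subseteq> {..<b}" "Suc (card F) = j" "b \<le> N" by (auto simp: I_def)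
    have l: "lrmins p = insert b F" and "length p = m" "climb p = N - b"
      using p by (auto simp: T_def seqs_def)
    moreover have "hd p = b"
      using l Max_lrmins[of p] Mx[OF F(1)] assms(1) \<open>length p = m\<close> by force
    moreover have "b \<notin> F" using F by auto
    ultimately show "p \<in> A" using F fin[OF F(1)] by (simp add: A_def)
  qed
  have T: "finite (T b F) \<and> card (T b F) = ballot m j * compositions (m - j) (N - b)"
    if "(b, F) \<in> I" for b F
  proof -
    have F: "F \<subseteq> {..<b}" "Suc (card F) = j" using that by (auto simp: I_def)
    then have "card (insert b F) = j" using fin[OF F(1)] by (subst card_insert_disjoint) auto
    then show ?thesis using seqs_finite_card[of "insert b F" m "N - b"] fin[OF F(1)]
      by (simp add: T_def)
  qed
  show "finite A" unfolding A using finI T by auto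
  have disj: "T b F \<inter> T c G = {}" if "(b, F) \<in> I" "(c, G) \<in> I" "(b, F) \<noteq> (c, G)" for b F c G
  proof (rule ccontr)
    assume "T b F \<inter> T c G \<noteq> {}"
    then have eq: "insert b F = insert c G" by (auto simp: T_def seqs_def)
    have FG: "F \<subseteq> {..<b}" "G \<subseteq> {..<c}" using that by (auto simp: I_def)
    then have "b = c" using Mx eq by metis
    moreover have "F = G" using eq FG \<open>b = c\<close> by (metis insert_ident lessThan_iff less_irrefl subsetD)
    ultimately show False using that by simp
  qed
  have "card A = (\<Sum>(b, F)\<in>I. card (T b F))"
    unfolding A using finI T disj by (subst card_UN_disjoint) (force simp: case_prod_unfold)+
  also have "\<dots> = (\<Sum>(b, F)\<in>I. ballot m j * compositions (m - j) (N - b))"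
    using T by (intro sum.cong) auto
  also have "\<dots> = (\<Sum>b\<le>N. \<Sum>F\<in>{F. F \<subseteq> {..<b} \<and> Suc (card F) = j}. ballot m j * compositions (m - j) (N - b))"
    unfolding I_def by (subst sum.Sigma) (auto intro: finite_subset[of _ "Pow {..<_}"])
  also have "\<dots> = ballot m j * (N choose (m - 1))"
  proof (cases j)
    case 0
    then show ?thesis using assms(1) by (cases m) auto
  next
    case (Suc i)
    have "card {F. F \<subseteq> {..<b} \<and> Suc (card F) = j} = b choose i" for b
      using n_subsets[of "{..<b}" i] Suc by simp
    then have "(\<Sum>b\<le>N. \<Sum>F\<in>{F. F \<subseteq> {..<b} \<and> Suc (card F) = j}. ballot m j * compositions (m - j) (N - b))
      = ballot m j * (\<Sum>b\<le>N. (b choose i) * compositions (m - j) (N - b))"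
      by (simp add: sum_distrib_left mult.left_commute)
    also have "\<dots> = ballot m j * (N choose (m - 1))"
    proof (cases "j \<le> m")
      case True
      then have "i + (m - j) = m - 1" using Suc by simp
      then show ?thesis by (simp add: sum_choose_mult_compositions)
    next
      case False
      then show ?thesis by (simp add: ballot_eq_0)
    qed
    finally show ?thesis .
  qed
  finally show "card A = ballot m j * (N choose (m - 1))" .
qed

section \<open>Fibonacci polyominoes and lists of column heights\<close>

text \<open>The corner \<open>(a, b)\<close> is a parameter, so that the staircases with fixed
  heights form a whole translation class.\<close>

definition staircase :: "int \<Rightarrow> int \<Rightarrow> nat list \<Rightarrow> cell set" where
  "staircase a b h = {(a + int i, b + int i + int k) | i k. i < length h \<and> k < h ! i}"

text \<open>The bound 2 expresses connectedness: the next column starts one row higher, so a column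
  of height 1 would not share a row with it.\<close>

definition heights :: "nat list set" where
  "heights = {h. h \<noteq> [] \<and> 1 \<le> last h \<and> (\<forall>i. Suc i < length h \<longrightarrow> 2 \<le> h ! i)}"

lemma heights_pos:
  assumes "h \<in> heights" "i < length h"
  shows "0 < h ! i"
proof (cases "Suc i < length h")
  case True
  then have "2 \<le> h ! i" using assms by (simp add: heights_def)
  then show ?thesis by simp
next
  case False
  then have "i = length h - 1" using assms by simp
  then show ?thesis using assms by (auto simp: heights_def last_conv_nth)
qed

lemma column_staircase:
  assumes "i < length h"
  shows "column (staircase a b h) (a + int i) = {b + int i..<b + int i + int (h ! i)}"
proof (intro equalityI subsetI)
  fix y assume "y \<in> {b + int i..<b + int i + int (h ! i)}"
  then have "y = b + int i + int (nat (y - b - int i))" "nat (y - b - int i) < h ! i" by auto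
  then show "y \<in> column (staircase a b h) (a + int i)"
    using assms unfolding column_def staircase_def by blast
qed (auto simp: column_def staircase_def)

lemma column_staircase_empty:
  "(\<And>i. i < length h \<Longrightarrow> x \<noteq> a + int i) \<Longrightarrow> column (staircase a b h) x = {}"
  by (auto simp: column_def staircase_def)

lemma mem_staircase_iff:
  "(x, y) \<in> staircase a b h \<longleftrightarrow> y \<in> column (staircase a b h) x"
  by (simp add: column_def)

lemma columns_staircase:
  assumes "h \<in> heights"
  shows "columns (staircase a b h) = (\<lambda>i. a + int i) ` {..<length h}"
proof (intro equalityI subsetI)
  fix x assume "x \<in> columns (staircase a b h)"
  then show "x \<in> (\<lambda>i. a + int i) ` {..<length h}"
    using column_staircase_empty[of h x a b] by (auto simp: columns_def)
next
  fix x assume "x \<in> (\<lambda>i. a + int i) ` {..<length h}"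
  then show "x \<in> columns (staircase a b h)"
    using heights_pos[OF assms] by (auto simp: columns_def column_staircase)
qed

lemma height_staircase: "i < length h \<Longrightarrow> height (staircase a b h) (a + int i) = h ! i"
  by (simp add: height_def column_staircase)

lemma translate_staircase:
  "(\<lambda>(x, y). (x + c, y + d)) ` staircase a b h = staircase (a + c) (b + d) h"
  unfolding staircase_def by (fastforce simp: image_iff algebra_simps)

text \<open>The number of columns and the leftmost column align the indices; heights are column
  sizes, which vertical shifts preserve.\<close>

lemma staircase_inject:
  assumes h: "h \<in> heights" and g: "g \<in> heights" and eq: "staircase a b h = staircase c d g"
  shows "h = g"
proof -
  have cols: "(\<lambda>i. a + int i) ` {..<length h} = (\<lambda>i. c + int i) ` {..<length g}"
    using columns_staircase[OF h] columns_staircase[OF g] eq by metis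
  have "card ((\<lambda>i. a + int i) ` {..<length h}) = length h" for a h
    by (simp add: card_image inj_on_def)
  then have len: "length h = length g" using cols by metis
  have Min: "Min ((\<lambda>i. a + int i) ` {..<length h}) = a" if "h \<noteq> []" for a h
    using that by (intro Min_eqI) (auto intro!: image_eqI[of _ _ 0])
  have "a = c" using Min[of h a] Min[of g c] cols h g by (auto simp: heights_def)
  show ?thesis
    using height_staircase len eq \<open>a = c\<close> by (intro nth_equalityI) metis+
qed

text \<open>A discrete intermediate value argument: a step changes the column by at most one, and a
  step that changes it stays in its row.\<close>

lemma rtrancl_adjacent_imp_crossing:
  assumes "(c, d) \<in> {(a, b). a \<in> P \<and> b \<in> P \<and> adjacent a b}\<^sup>*" "fst c \<le> x" "x < fst d"
  shows "\<exists>y. (x, y) \<in> P \<and> (x + 1, y) \<in> P"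
  using assms
proof (induction rule: rtrancl_induct)
  case base
  then show ?case by simp
next
  case (step d e)
  show ?case
  proof (cases "x < fst d")
    case True
    then show ?thesis using step by simp
  next
    case False
    then have "fst d = x \<and> fst e = x + 1 \<and> snd d = snd e"
      using step by (auto simp: adjacent_def)
    then show ?thesis using step by (intro exI[of _ "snd d"]) (cases d; cases e; simp)
  qed
qed

text \<open>Crossings serve twice: they exclude gaps between the extreme columns, and they make
  neighbouring columns share a row, which forces the heights. Convexity turns each column into an
  interval.\<close>

lemma fibonacci_imp_staircase:
  assumes "fibonacci_polyomino P"
  shows "\<exists>a b. \<exists>h\<in>heights. P = staircase a b h"
proof -
  have fin: "finite P" and ne: "P \<noteq> {}"
    and conn: "\<And>c d. c \<in> P \<Longrightarrow> d \<in> P \<Longrightarrow> (c, d) \<in> {(a, b). a \<in> P \<and> b \<in> P \<and> adjacent a b}\<^sup>*"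
    and conv: "\<And>x y z. y \<in> column P x \<Longrightarrow> z \<in> column P x \<Longrightarrow> {y..z} \<subseteq> column P x"
    and bot: "\<And>x. x \<in> columns P \<Longrightarrow> x + 1 \<in> columns P \<Longrightarrow>
      Min (column P (x + 1)) = Min (column P x) + 1"
    using assms by (auto simp: fibonacci_polyomino_def polyomino_def column_convex_def)
  have cols: "columns P = fst ` P"
    by (force simp: columns_def column_def)
  have fincol: "finite (column P x)" for x
    by (rule finite_subset[of _ "snd ` P"]) (use fin in \<open>force simp: column_def\<close>)+
  define a e where "a = Min (columns P)" and "e = Max (columns P)"
  have fc: "finite (columns P)" "columns P \<noteq> {}" using fin ne by (auto simp: cols)
  have a: "a \<in> columns P" and e: "e \<in> columns P" and bounds: "\<And>x. x \<in> columns P \<Longrightarrow> a \<le> x \<and> x \<le> e"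
    using fc by (auto simp: a_def e_def)
  have cross: "\<exists>y. (x, y) \<in> P \<and> (x + 1, y) \<in> P" if "a \<le> x" "x < e" for x
  proof -
    obtain c d where "c \<in> P" "fst c = a" "d \<in> P" "fst d = e"
      using a e by (auto simp: cols)
    then show ?thesis using rtrancl_adjacent_imp_crossing[OF conn] that by metis
  qed
  define m where "m = nat (e - a + 1)"
  have "a \<le> e" using bounds a by auto
  have mem: "a + int i \<in> columns P" if "i < m" for i
  proof (cases "a + int i = e")
    case True
    then show ?thesis using e by simp
  next
    case False
    then have "a + int i < e" using that by (simp add: m_def)
    then obtain y where "(a + int i, y) \<in> P" using cross[of "a + int i"] by auto
    then show ?thesis by (auto simp: columns_def column_def)
  qed
  define b where "b = Min (column P a)"
  have Min_col: "Min (column P (a + int i)) = b + int i" if "i < m" for i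
    using that
  proof (induction i)
    case 0
    then show ?case by (simp add: b_def)
  next
    case (Suc i)
    have "a + int (Suc i) = a + int i + 1" by simp
    then show ?case
      using bot[of "a + int i"] mem[of i] mem[of "Suc i"] Suc
      by (metis Suc_lessD add.assoc of_nat_Suc add.commute)
  qed
  define h where "h = map (\<lambda>i. height P (a + int i)) [0..<m]"
  have len: "length h = m" and nth: "\<And>i. i < m \<Longrightarrow> h ! i = height P (a + int i)"
    by (simp_all add: h_def)
  have col: "column P (a + int i) = {b + int i..<b + int i + int (h ! i)}" if "i < m" for i
  proof -
    let ?C = "column P (a + int i)"
    have ne: "?C \<noteq> {}" using mem[OF that] by (simp add: columns_def)
    have "{Min ?C..Max ?C} \<subseteq> ?C" using conv ne fincol by (simp add: Min_in Max_in)
    then have C: "?C = {Min ?C..Max ?C}" using fincol by auto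
    have "card ?C = nat (Max ?C + 1 - Min ?C)" using arg_cong[OF C, of card] by simp
    moreover have "Min ?C \<le> Max ?C" using ne fincol by (simp add: Max_in)
    ultimately have "Max ?C = Min ?C + int (h ! i) - 1"
      using nth[OF that] by (simp add: height_def)
    then have "?C = {b + int i..b + int i + int (h ! i) - 1}" using C Min_col[OF that] by metis
    moreover have "{b + int i..b + int i + int (h ! i) - 1} = {b + int i..<b + int i + int (h ! i)}"
      by auto
    ultimately show ?thesis by (rule trans)
  qed
  have "P = staircase a b h"
  proof -
    have "column P x = column (staircase a b h) x" for x
    proof (cases "\<exists>i<m. x = a + int i")
      case True
      then show ?thesis using col len column_staircase by auto
    next
      case False
      then have "x \<notin> columns P"
        using bounds[of x] by (auto simp: m_def dest: spec[of _ "nat (x - a)"])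
      moreover have "column (staircase a b h) x = {}"
        using False len by (intro column_staircase_empty) auto
      ultimately show ?thesis by (simp add: columns_def)
    qed
    then show ?thesis by (auto simp: column_def set_eq_iff)
  qed
  moreover have "h \<in> heights"
  proof -
    have m: "m \<noteq> 0" using \<open>a \<le> e\<close> by (simp add: m_def)
    have "1 \<le> h ! i" if "i < m" for i
      using col[OF that] mem[OF that] by (cases "h ! i") (auto simp: columns_def)
    \<comment> \<open>A row shared with the next column is at least \<open>b + i + 1\<close>, hence
      lies above the bottom cell of column \<open>i\<close>.\<close>
    moreover have "2 \<le> h ! i" if "Suc i < m" for i
    proof -
      have "a \<le> a + int i" "a + int i < e" using that by (auto simp: m_def)
      then obtain y where "(a + int i, y) \<in> P" "(a + int i + 1, y) \<in> P" using cross by blast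
      moreover have "a + int i + 1 = a + int (Suc i)" by simp
      ultimately have y: "y \<in> column P (a + int i)" "y \<in> column P (a + int (Suc i))"
        by (simp_all only: column_def mem_Collect_eq)
      then show ?thesis using col[of i] col[of "Suc i"] that by auto
    qed
    ultimately show ?thesis using m len by (auto simp: heights_def last_conv_nth)
  qed
  ultimately show ?thesis by blast
qed

text \<open>For connectedness, every cell is joined to the corner: go down to the bottom of its
  column, then left into the second cell of the previous column, which exists by the height bound,
  and repeat.\<close>

lemma staircase_fibonacci:
  assumes h: "h \<in> heights"
  shows "fibonacci_polyomino (staircase a b h)"
proof -
  let ?P = "staircase a b h"
  let ?r = "{(c, d). c \<in> ?P \<and> d \<in> ?P \<and> adjacent c d}"
  have memP: "(a + int i, b + int i + int k) \<in> ?P" if "i < length h" "k < h ! i" for i k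
    using that by (auto simp: staircase_def)
  have sym: "sym ?r" by (auto simp: sym_def adjacent_def)
  have down: "((a + int i, b + int i + int k), (a + int i, b + int i)) \<in> ?r\<^sup>*"
    if "i < length h" "k < h ! i" for i k
    using that(2)
  proof (induction k)
    case (Suc k)
    have "((a + int i, b + int i + int (Suc k)), (a + int i, b + int i + int k)) \<in> ?r"
      using Suc memP[OF that(1), of "Suc k"] memP[OF that(1), of k] by (auto simp: adjacent_def)
    then show ?case using Suc by (auto intro: converse_rtrancl_into_rtrancl)
  qed simp
  have left: "((a + int i, b + int i), (a, b)) \<in> ?r\<^sup>*" if "i < length h" for i
    using that
  proof (induction i)
    case (Suc i)
    have "2 \<le> h ! i" using h Suc.prems by (simp add: heights_def)
    then have "((a + int (Suc i), b + int (Suc i)), (a + int i, b + int i + int 1)) \<in> ?r"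
      using memP[of "Suc i" 0] memP[of i 1] Suc.prems heights_pos[OF h Suc.prems]
      by (auto simp: adjacent_def algebra_simps)
    also have "((a + int i, b + int i + int 1), (a + int i, b + int i)) \<in> ?r\<^sup>*"
      using Suc.prems \<open>2 \<le> h ! i\<close> by (intro down) auto
    also have "((a + int i, b + int i), (a, b)) \<in> ?r\<^sup>*" using Suc by simp
    finally show ?case by simp
  qed simp
  have to: "(c, (a, b)) \<in> ?r\<^sup>*" if c: "c \<in> ?P" for c
  proof -
    obtain i k where "c = (a + int i, b + int i + int k)" "i < length h" "k < h ! i"
      using c by (auto simp: staircase_def)
    then show ?thesis using rtrancl_trans[OF down left] by simp
  qed
  have conn: "(c, d) \<in> ?r\<^sup>*" if "c \<in> ?P" "d \<in> ?P" for c d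
    using to[OF that(1)] to[OF that(2)] sym_rtrancl[OF sym]
    by (meson rtrancl_trans symD)
  have "?P = (\<lambda>(i, k). (a + int i, b + int i + int k)) ` (SIGMA i:{..<length h}. {..<h ! i})"
    by (auto simp: staircase_def image_iff)
  then have "finite ?P" by simp
  moreover have "?P \<noteq> {}"
    using memP[of 0 0] heights_pos[OF h, of 0] h by (auto simp: heights_def)
  moreover have "column_convex ?P"
  proof -
    have "{y..z} \<subseteq> column ?P x" if yz: "y \<in> column ?P x" "z \<in> column ?P x" for x y z
    proof -
      have "column ?P x \<noteq> {}" using yz by auto
      then obtain i where "i < length h" "x = a + int i" using column_staircase_empty by blast
      then show ?thesis using yz by (auto simp: column_staircase)
    qed
    then show ?thesis by (simp add: column_convex_def)
  qed
  moreover have "Min (column ?P (x + 1)) = Min (column ?P x) + 1"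
    if x: "x \<in> columns ?P" "x + 1 \<in> columns ?P" for x
  proof -
    have Min: "Min {c..<c + int k} = c" if "0 < k" for c k
      using that by (intro Min_eqI) auto
    obtain i where i: "i < length h" "x = a + int i" using x by (auto simp: columns_staircase[OF h])
    obtain i' where i': "i' < length h" "x + 1 = a + int i'"
      using x by (auto simp: columns_staircase[OF h])
    have "Min (column ?P (x + 1)) = b + int i'"
      unfolding i'(2) column_staircase[OF i'(1)] by (intro Min heights_pos[OF h] i'(1))
    moreover have "Min (column ?P x) = b + int i"
      unfolding i(2) column_staircase[OF i(1)] by (intro Min heights_pos[OF h] i(1))
    ultimately show ?thesis using i(2) i'(2) by simp
  qed
  ultimately show ?thesis
    using conn by (auto simp: fibonacci_polyomino_def polyomino_def)
qed

section \<open>Semiperimeters and left-to-right minima of staircases\<close>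

lemma horizontal_semiperimeter_staircase:
  assumes h: "h \<in> heights"
  shows "horizontal_semiperimeter (staircase a b h) = real (length h)"
proof -
  \<comment> \<open>Each column contributes its bottom edge \<open>?f i\<close> and its top edge
    \<open>?g i\<close>.\<close>
  let ?f = "\<lambda>i. (a + int i, b + int i)" and ?g = "\<lambda>i. (a + int i, b + int i + int (h ! i))"
  have "horizontal_boundary (staircase a b h) = ?f ` {..<length h} \<union> ?g ` {..<length h}"
  proof (intro equalityI subsetI; clarify)
    fix x y assume xy: "(x, y) \<in> horizontal_boundary (staircase a b h)"
      "(x, y) \<notin> ?g ` {..<length h}"
    then have "column (staircase a b h) x \<noteq> {}"
      by (auto simp: horizontal_boundary_def mem_staircase_iff)
    then obtain i where i: "i < length h" "x = a + int i" using column_staircase_empty by blast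
    then show "(x, y) \<in> ?f ` {..<length h}"
      using xy by (auto simp: horizontal_boundary_def mem_staircase_iff column_staircase)
  next
    fix x y assume "(x, y) \<in> ?f ` {..<length h} \<union> ?g ` {..<length h}"
    then show "(x, y) \<in> horizontal_boundary (staircase a b h)"
      using heights_pos[OF h]
      by (auto simp: horizontal_boundary_def mem_staircase_iff column_staircase)
  qed
  moreover have "?f ` {..<length h} \<inter> ?g ` {..<length h} = {}"
    using heights_pos[OF h] by fastforce
  moreover have "card (?f ` {..<length h}) = length h" "card (?g ` {..<length h}) = length h"
    by (simp_all add: card_image inj_on_def)
  ultimately show ?thesis
    by (simp add: horizontal_semiperimeter_def card_Un_disjoint)
qed

text \<open>With \<open>d = b + 1 - a\<close> for neighbouring heights \<open>a\<close>,
  \<open>b\<close>, one has \<open>1 + \<bar>d\<bar> = 2 * max 0 d + (a - b)\<close>. The first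
  parts add up to twice the climb, the differences telescope.\<close>

lemma sum_abs_steps:
  "h \<noteq> [] \<Longrightarrow> (\<Sum>i<length h - 1. 1 + \<bar>int (h ! Suc i) + 1 - int (h ! i)\<bar>) =
     2 * int (climb h) + int (hd h) - int (last h)"
proof (induction h rule: climb.induct)
  case (1 a b q)
  have "(\<Sum>i<length (a # b # q) - 1. 1 + \<bar>int ((a # b # q) ! Suc i) + 1 - int ((a # b # q) ! i)\<bar>)
    = 1 + \<bar>int b + 1 - int a\<bar> +
      (\<Sum>i<length (b # q) - 1. 1 + \<bar>int ((b # q) ! Suc i) + 1 - int ((b # q) ! i)\<bar>)"
    by (simp add: sum.lessThan_Suc_shift del: sum.lessThan_Suc)
  then show ?case using 1 by simp
qed auto

text \<open>The bottom cell of the left column is always unmatched; the remaining unmatched cells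
  are the difference between the two tops.\<close>

lemma card_symdiff_intervals:
  assumes "2 \<le> p" "0 < q"
  shows "int (card {y. (y \<in> {c + 1..<c + 1 + int q}) \<noteq> (y \<in> {c..<c + int p})}) =
    1 + \<bar>int q + 1 - int p\<bar>"
proof (cases "p \<le> Suc q")
  case True
  have "{y. (y \<in> {c + 1..<c + 1 + int q}) \<noteq> (y \<in> {c..<c + int p})} =
      insert c {c + int p..<c + 1 + int q}"
    using assms True by auto
  then show ?thesis using assms True by simp
next
  case False
  have "{y. (y \<in> {c + 1..<c + 1 + int q}) \<noteq> (y \<in> {c..<c + int p})} =
      insert c {c + 1 + int q..<c + int p}"
    using assms False by auto
  then show ?thesis using assms False by simp
qed

text \<open>Edges are counted along each vertical grid line. The rightmost line contributes
  \<open>last h\<close>, which cancels the \<open>- last h\<close> of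
  \<open>sum_abs_steps\<close>.\<close>

lemma vertical_semiperimeter_staircase:
  assumes h: "h \<in> heights"
  shows "vertical_semiperimeter (staircase a b h) = real (hd h + climb h)"
proof -
  let ?P = "staircase a b h"
  define m where "m = length h - 1"
  have len: "length h = Suc m" using h by (auto simp: m_def heights_def)
  define D where "D i = {y. (y \<in> column ?P (a + int i)) \<noteq> (y \<in> column ?P (a + int i - 1))}" for i
  have before: "column ?P (a - 1) = {}" by (rule column_staircase_empty) auto
  have after: "column ?P (a + int (Suc m)) = {}" by (rule column_staircase_empty) (auto simp: len)
  have D0: "D 0 = {b..<b + int (hd h)}"
    using column_staircase[of 0 h a b] before h by (auto simp: D_def len heights_def hd_conv_nth)
  have Dm: "D (Suc m) = {b + int m..<b + int m + int (last h)}"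
    using column_staircase[of m h a b] after h by (auto simp: D_def len heights_def last_conv_nth)
  have Di: "D (Suc i) = {y. (y \<in> {(b + int i) + 1..<(b + int i) + 1 + int (h ! Suc i)}) \<noteq>
      (y \<in> {b + int i..<b + int i + int (h ! i)})}" if "i < m" for i
    using that column_staircase[of i h a b] column_staircase[of "Suc i" h a b]
    by (simp add: D_def len algebra_simps)
  have cDi: "int (card (D (Suc i))) = 1 + \<bar>int (h ! Suc i) + 1 - int (h ! i)\<bar>" if "i < m" for i
    unfolding Di[OF that]
    by (rule card_symdiff_intervals) (use that h heights_pos[OF h] in \<open>auto simp: heights_def len\<close>)
  have finD: "finite (D i)" if "i \<le> Suc m" for i
  proof (cases i)
    case 0
    then show ?thesis by (simp add: D0)
  next
    case (Suc k)
    \<comment> \<open>An infinite set has \<open>card\<close> 0, so the positive cardinality in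
      \<open>cDi\<close> implies finiteness.\<close>
    then show ?thesis using that Dm cDi[of k]
      by (cases "k = m") (auto intro: card_ge_0_finite)
  qed
  have "vertical_boundary ?P = (\<lambda>(i, y). (a + int i, y)) ` (SIGMA i:{..Suc m}. D i)"
  proof (intro equalityI subsetI)
    fix c assume "c \<in> vertical_boundary ?P"
    then obtain x y where c: "c = (x, y)" and xy: "(y \<in> column ?P x) \<noteq> (y \<in> column ?P (x - 1))"
      by (auto simp: vertical_boundary_def mem_staircase_iff)
    then have "column ?P x \<noteq> {} \<or> column ?P (x - 1) \<noteq> {}" by auto
    then obtain i where "i < length h" "x = a + int i \<or> x = a + int (Suc i)"
      using column_staircase_empty[of h x a b] column_staircase_empty[of h "x - 1" a b]
      by (fastforce simp: algebra_simps)
    then obtain i where "i \<le> Suc m" "x = a + int i" using len by (metis Suc_leI less_imp_le less_Suc_eq_le)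
    then show "c \<in> (\<lambda>(i, y). (a + int i, y)) ` (SIGMA i:{..Suc m}. D i)"
      using xy by (auto simp: c D_def image_iff)
  qed (auto simp: D_def vertical_boundary_def mem_staircase_iff)
  then have "card (vertical_boundary ?P) = card (SIGMA i:{..Suc m}. D i)"
    by (simp add: card_image inj_on_def)
  also have "\<dots> = (\<Sum>i\<le>Suc m. card (D i))" using finD by simp
  also have "\<dots> = card (D 0) + (\<Sum>i<m. card (D (Suc i))) + card (D (Suc m))"
    by (simp only: sum.atMost_shift sum.lessThan_Suc add.assoc)
  finally have "int (card (vertical_boundary ?P)) =
      int (hd h) + (\<Sum>i<m. 1 + \<bar>int (h ! Suc i) + 1 - int (h ! i)\<bar>) + int (last h)"
    by (simp add: D0 Dm cDi)
  also have "\<dots> = int (2 * (hd h + climb h))"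
    using sum_abs_steps[of h] h by (simp add: m_def heights_def)
  finally have "card (vertical_boundary ?P) = 2 * (hd h + climb h)" by linarith
  then show ?thesis by (simp add: vertical_semiperimeter_def)
qed

lemma lrmins_conv_nth: "lrmins h = (!) h ` {i. i < length h \<and> (\<forall>k<i. h ! i < h ! k)}"
proof (induction h)
  case Nil
  then show ?case by simp
next
  case (Cons a q)
  have "{i. i < length (a # q) \<and> (\<forall>k<i. (a # q) ! i < (a # q) ! k)} =
      insert 0 (Suc ` {i. i < length q \<and> (\<forall>k<i. q ! i < q ! k) \<and> q ! i < a})" (is "?L = ?R")
  proof (rule set_eqI)
    fix i
    show "i \<in> ?L \<longleftrightarrow> i \<in> ?R"
      by (cases i) (auto simp: All_less_Suc2)
  qed
  then have "(!) (a # q) ` {i. i < length (a # q) \<and> (\<forall>k<i. (a # q) ! i < (a # q) ! k)} =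
      insert a ((!) q ` {i. i < length q \<and> (\<forall>k<i. q ! i < q ! k) \<and> q ! i < a})"
    by (simp add: image_image)
  then show ?case by (auto simp: Cons.IH)
qed

lemma lmin_staircase:
  assumes h: "h \<in> heights"
  shows "lmin (staircase a b h) = card (lrmins h)"
proof -
  let ?P = "staircase a b h"
  let ?I = "{i. i < length h \<and> (\<forall>k<i. h ! i < h ! k)}"
  have prev: "{x' \<in> columns ?P. x' < a + int i} = (\<lambda>i. a + int i) ` {..<i}" if "i < length h" for i
    using that by (auto simp: columns_staircase[OF h])
  have "{x \<in> columns ?P. {x' \<in> columns ?P. x' < x} = {} \<or>
      height ?P x < Min (height ?P ` {x' \<in> columns ?P. x' < x})} = (\<lambda>i. a + int i) ` ?I"
  proof -
    have "({x' \<in> columns ?P. x' < a + int i} = {} \<or>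
        height ?P (a + int i) < Min (height ?P ` {x' \<in> columns ?P. x' < a + int i})) \<longleftrightarrow>
        (\<forall>k<i. h ! i < h ! k)" if i: "i < length h" for i
    proof -
      have "height ?P ` (\<lambda>i. a + int i) ` {..<i} = (!) h ` {..<i}"
        unfolding image_image using i by (intro image_cong) (auto simp: height_staircase)
      then show ?thesis
        unfolding prev[OF i] using i
        by (cases "i = 0") (simp_all add: height_staircase lessThan_empty_iff, auto)
    qed
    then show ?thesis by (auto simp: columns_staircase[OF h])
  qed
  then have "lmin ?P = card ?I"
    by (simp add: lmin_def card_image inj_on_def)
  \<comment> \<open>Of two positions of minima the later has the strictly smaller value, so counting
    values is counting positions.\<close>
  also have "\<dots> = card (lrmins h)"
    unfolding lrmins_conv_nth
    by (rule card_image[symmetric])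
      (auto simp: inj_on_def, metis linorder_neqE_nat less_irrefl)
  finally show ?thesis .
qed

section \<open>Translation classes and their height lists\<close>

definition height_lists :: "nat \<Rightarrow> nat \<Rightarrow> nat \<Rightarrow> nat list set" where
  "height_lists m n j = {h \<in> heights. length h = m \<and> hd h + climb h = n \<and> card (lrmins h) = j}"

lemma fibonacci_polyominoes_eq:
  "{P \<in> fibonacci_polyominoes m n. lmin P = j} = {staircase a b h | a b h. h \<in> height_lists m n j}"
  (is "?L = ?R")
proof (intro equalityI subsetI)
  fix P assume P: "P \<in> ?L"
  then have "fibonacci_polyomino P" by (simp add: fibonacci_polyominoes_def)
  then obtain a b h where "h \<in> heights" "P = staircase a b h"
    using fibonacci_imp_staircase by blast
  moreover from this have "h \<in> height_lists m n j"
    using P horizontal_semiperimeter_staircase[of h] vertical_semiperimeter_staircase[of h]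
      lmin_staircase[of h]
    by (simp add: fibonacci_polyominoes_def height_lists_def flip: of_nat_add)
  ultimately show "P \<in> ?R" by blast
next
  fix P assume "P \<in> ?R"
  then show "P \<in> ?L"
    using horizontal_semiperimeter_staircase vertical_semiperimeter_staircase lmin_staircase
      staircase_fibonacci
    by (auto simp: fibonacci_polyominoes_def height_lists_def)
qed

lemma translation_class_staircase:
  "translation `` {staircase a b h} = {staircase c d h | c d. True}"
proof -
  have "\<exists>a' b'. staircase c d h = staircase (a + a') (b + b') h" for c d
    by (rule exI[of _ "c - a"], rule exI[of _ "d - b"]) simp
  then show ?thesis by (auto simp: translation_def translate_staircase)
qed

text \<open>Every class contains exactly one staircase with corner \<open>(0, 0)\<close>, which
  serves as its canonical representative.\<close>

lemma bij_betw_height_lists_quotient: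
  "bij_betw (\<lambda>h. translation `` {staircase 0 0 h}) (height_lists m n j)
     ({P \<in> fibonacci_polyominoes m n. lmin P = j} // translation)"
  unfolding bij_betw_def
proof
  show "inj_on (\<lambda>h. translation `` {staircase 0 0 h}) (height_lists m n j)"
  proof (rule inj_onI)
    fix h g assume hg: "h \<in> height_lists m n j" "g \<in> height_lists m n j"
      and eq: "translation `` {staircase 0 0 h} = translation `` {staircase 0 0 g}"
    have "staircase 0 0 h \<in> translation `` {staircase 0 0 h}"
      unfolding translation_class_staircase by blast
    then have "staircase 0 0 h \<in> translation `` {staircase 0 0 g}" by (simp only: eq)
    then obtain c d where "staircase 0 0 h = staircase c d g"
      unfolding translation_class_staircase by blast
    then show "h = g"
      using staircase_inject hg by (auto simp: height_lists_def)
  qed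
  have "translation `` {staircase a b h} = translation `` {staircase 0 0 h}" for a b h
    by (simp only: translation_class_staircase)
  then show "(\<lambda>h. translation `` {staircase 0 0 h}) ` height_lists m n j =
      {P \<in> fibonacci_polyominoes m n. lmin P = j} // translation"
    unfolding fibonacci_polyominoes_eq quotient_def by blast
qed

section \<open>Counting\<close>

lemma climb_map_add: "climb (map (\<lambda>x. x + c) p) = climb p"
  by (induction p rule: climb.induct) auto

lemma lrmins_map_add: "lrmins (map (\<lambda>x. x + c) p) = (\<lambda>x. x + c) ` lrmins p"
  by (induction p) auto

text \<open>The last step leads from a height of at least 2 to 1, so the top does not rise.\<close>

lemma climb_snoc_1: "p \<noteq> [] \<Longrightarrow> climb (map (\<lambda>x. x + 2) p @ [1]) = climb p"
  by (induction p rule: climb.induct) auto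

lemma lrmins_snoc_1: "lrmins (map (\<lambda>x. x + 2) p @ [1]) = insert 1 ((\<lambda>x. x + 2) ` lrmins p)"
  by (induction p) auto

lemma snoc_in_heights: "hs @ [l] \<in> heights \<longleftrightarrow> 1 \<le> l \<and> (\<forall>x\<in>set hs. 2 \<le> x)"
  by (auto simp: heights_def nth_append all_set_conv_all_nth)

lemma height_lists_finite_card:
  assumes m: "2 \<le> m" and n: "2 \<le> n" and j: "1 \<le> j"
  shows "finite (height_lists m n j)"
    "card (height_lists m n j) =
      ballot m j * ((n - 2) choose (m - 1)) + ballot (m - 1) (j - 1) * ((n - 2) choose (m - 2))"
proof -
  \<comment> \<open>Lowering the heights by 2 lowers the first one by 2 and leaves the climb
    unchanged. A final 1 adds one column and one minimum, whence
    \<open>A (m - 1) (j - 1)\<close>.\<close>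
  define A where "A m j = {p. length p = m \<and> hd p + climb p = n - 2 \<and> card (lrmins p) = j}" for m j
  have fin: "finite (A m j)" "finite (A (m - 1) (j - 1))"
    and card: "card (A m j) = ballot m j * ((n - 2) choose (m - 1))"
      "card (A (m - 1) (j - 1)) = ballot (m - 1) (j - 1) * ((n - 2) choose (m - 2))"
    using card_lists_by_lrmins[of m "n - 2" j] card_lists_by_lrmins[of "m - 1" "n - 2" "j - 1"] m
    by (simp_all add: A_def numeral_2_eq_2)
  let ?f = "map (\<lambda>x::nat. x + 2)" and ?g = "\<lambda>p. map (\<lambda>x::nat. x + 2) p @ [1]"
  have card2: "card ((\<lambda>x. x + 2) ` S) = card S" for S :: "nat set"
    by (simp add: card_image inj_on_def)
  have f: "?f p \<in> height_lists m n j \<longleftrightarrow> p \<in> A m j" for p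
  proof (cases p rule: rev_cases)
    case Nil
    then show ?thesis using m by (simp add: height_lists_def A_def)
  next
    case (snoc q l)
    have "?f p \<in> heights" unfolding snoc by (simp add: snoc_in_heights)
    moreover have "hd (?f p) = hd p + 2" by (cases q) (simp_all add: snoc)
    moreover have "card (lrmins (?f p)) = card (lrmins p)" unfolding lrmins_map_add by (rule card2)
    ultimately show ?thesis
      using n climb_map_add[of 2 p] by (auto simp: height_lists_def A_def)
  qed
  have g: "?g p \<in> height_lists m n j \<longleftrightarrow> p \<in> A (m - 1) (j - 1)" for p
  proof (cases "p = []")
    case True
    then show ?thesis using m by (auto simp: height_lists_def A_def)
  next
    case False
    have "?g p \<in> heights" by (simp add: snoc_in_heights)
    moreover have "hd (?g p) = hd p + 2" using False by (simp add: hd_map)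
    moreover have "card (lrmins (?g p)) = Suc (card (lrmins p))"
      unfolding lrmins_snoc_1 by (subst card_insert_disjoint) (auto simp: card_image inj_on_def)
    ultimately show ?thesis
      using n m j climb_snoc_1[OF False] by (auto simp: height_lists_def A_def)
  qed
  have eq: "height_lists m n j = ?f ` A m j \<union> ?g ` A (m - 1) (j - 1)"
  proof (intro equalityI subsetI)
    fix h assume h: "h \<in> height_lists m n j"
    then have H: "h \<in> heights" by (simp add: height_lists_def)
    then obtain hs l where hl: "h = hs @ [l]"
      by (cases h rule: rev_cases) (auto simp: heights_def)
    have sub: "?f (map (\<lambda>x. x - 2) xs) = xs" if "\<forall>x\<in>set xs. 2 \<le> x" for xs :: "nat list"
      using that by (induction xs) auto
    have l: "1 \<le> l" "\<forall>x\<in>set hs. 2 \<le> x" using H by (simp_all add: hl snoc_in_heights)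
    show "h \<in> ?f ` A m j \<union> ?g ` A (m - 1) (j - 1)"
    proof (cases "l = 1")
      case True
      then have "h = ?g (map (\<lambda>x. x - 2) hs)" using sub[OF l(2)] by (simp add: hl)
      then show ?thesis using g h by blast
    next
      case False
      then have "?f (map (\<lambda>x. x - 2) h) = h" using sub[of h] l by (simp add: hl)
      then obtain q where "h = ?f q" by metis
      then show ?thesis using f h by blast
    qed
  next
    fix h assume "h \<in> ?f ` A m j \<union> ?g ` A (m - 1) (j - 1)"
    then show "h \<in> height_lists m n j" using f g by blast
  qed
  \<comment> \<open>The last entry separates the two images.\<close>
  have "last (?f p) \<noteq> 1" if "p \<in> A m j" for p
    using that m by (cases p rule: rev_cases) (auto simp: A_def)
  then have "?f ` A m j \<inter> ?g ` A (m - 1) (j - 1) = {}" by fastforce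
  moreover have "inj_on ?f (A m j)" "inj_on ?g (A (m - 1) (j - 1))"
    by (auto simp: inj_on_def inj_map_eq_map)
  ultimately show "finite (height_lists m n j)" "card (height_lists m n j) =
      ballot m j * ((n - 2) choose (m - 1)) + ballot (m - 1) (j - 1) * ((n - 2) choose (m - 2))"
    using fin card unfolding eq
    by (simp_all only: card_Un_disjoint card_image finite_Un finite_imageI)
qed

lemma height_lists_1: "1 \<le> n \<Longrightarrow> height_lists 1 n j = (if j = 1 then {[n]} else {})"
  by (auto simp: height_lists_def heights_def length_Suc_conv)

theorem corollary4p3:
  shows "(\<forall>m n j :: nat. 2 \<le> m \<and> 2 \<le> n \<and> 1 \<le> j \<longrightarrow>
            finite ({P \<in> fibonacci_polyominoes m n. lmin P = j} // translation) \<and>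
            real (card ({P \<in> fibonacci_polyominoes m n. lmin P = j} // translation)) =
              B m j * real ((n - 2) choose (m - 1)) +
              B (m - 1) (j - 1) * real ((n - 2) choose (m - 2))) \<and>
         (\<forall>n :: nat. 1 \<le> n \<longrightarrow>
            card (fibonacci_polyominoes 1 n // translation) = 1 \<and>
            (\<forall>P \<in> fibonacci_polyominoes 1 n. lmin P = 1))"
proof (intro conjI allI impI)
  fix m n j :: nat assume "2 \<le> m \<and> 2 \<le> n \<and> 1 \<le> j"
  then have "2 \<le> m" "2 \<le> n" "1 \<le> j" by auto
  note count = height_lists_finite_card[OF this]
  show "finite ({P \<in> fibonacci_polyominoes m n. lmin P = j} // translation)"
    using bij_betw_finite[OF bij_betw_height_lists_quotient] count(1) by blast
  show "real (card ({P \<in> fibonacci_polyominoes m n. lmin P = j} // translation)) =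
      B m j * real ((n - 2) choose (m - 1)) + B (m - 1) (j - 1) * real ((n - 2) choose (m - 2))"
    unfolding bij_betw_same_card[OF bij_betw_height_lists_quotient, symmetric] count(2)
    by (simp add: ballot_eq_B)
next
  fix n :: nat assume n: "1 \<le> n"
  have lmin: "lmin P = 1" if "P \<in> fibonacci_polyominoes 1 n" for P
  proof -
    \<comment> \<open>The description by height lists is applied with \<open>j = lmin P\<close>; for
      one column the set of lists is empty unless this is 1.\<close>
    have "P \<in> {Q \<in> fibonacci_polyominoes 1 n. lmin Q = lmin P}" using that by simp
    then show ?thesis
      unfolding fibonacci_polyominoes_eq height_lists_1[OF n] by (auto split: if_splits)
  qed
  then show "\<forall>P\<in>fibonacci_polyominoes 1 n. lmin P = 1" by blast
  have "fibonacci_polyominoes 1 n = {P \<in> fibonacci_polyominoes 1 n. lmin P = 1}"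
    using lmin by blast
  then show "card (fibonacci_polyominoes 1 n // translation) = 1"
    using bij_betw_same_card[OF bij_betw_height_lists_quotient, of 1 n 1] height_lists_1[OF n, of 1]
    by simp
qed

end
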